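(* Let $L$ be a PG-lattice and let $M$ be a faithful multiplication PG-lattice $L$-module with $I_M$ compact. If a proper element $N\in M$ is pseudo-primary, then $rad(N)$ is a prime element of $M$.
   Context: A multiplicative lattice $L$ is a complete lattice (least element $0$, greatest element $1$) with a commutative, associative multiplication that distributes over arbitrary joins and has $1$ as identity. An element $a$ of a complete lattice is compact if $a\leqslant \bigvee X$ implies $a\leqslant x_1\vee\cdots\vee x_n$ for finitely many $x_i\in X$. Standing assumption: every element of $L$ is a join of compact elements of $L$, $1$ is compact, and finite products of compact elements of $L$ are compact. For $a,b\in L$, $(a:b)=\bigvee\{x\in L\mid xb\leqslant a\}$. An element $e\in L$ is principal if $a\wedge be=((a:e)\wedge b)e$ and $(ae\vee b):e=(b:e)\vee a$ for all $a,b\in L$. $L$ is a PG-lattice if each element of $L$ is a join of principal elements of $L$. An $L$-module $M$ is a complete lattice (least element $O_M$, greatest element $I_M$) with a multiplication $L\times M\to M$, $(a,A)\mapsto aA$, such that $(\bigvee_\alpha a_\alpha)A=\bigvee_\alpha a_\alpha A$, $a(\bigvee_\alpha A_\alpha)=\bigvee_\alpha aA_\alpha$, $(ab)A=a(bA)$, $1A=A$, $0A=O_M$. For $A,B\in M$, $(A:B)=\bigvee\{x\in L\mid xB\leqslant A\}\in L$. $M$ is faithful if $(O_M:I_M)=0$; $M$ is a multiplication lattice module if every $N\in M$ has the form $N=aI_M$ with $a\in L$. An element $N\in M$ is principal if $(b\wedge(B:N))N=bN\wedge B$ and $b\vee(B:N)=((bN\vee B):N)$ for all $b\in L$, $B\in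 M$; $M$ is a PG-lattice $L$-module if each element of $M$ is a join of principal elements of $M$. $N\in M$ is proper if $N<I_M$. A proper $N\in M$ is prime if for all $a\in L$, $X\in M$, $aX\leqslant N$ implies $X\leqslant N$ or $aI_M\leqslant N$. For a proper $N$, $rad(N)=\bigwedge\{P\in M\mid P\text{ is prime and }N\leqslant P\}$ (the empty meet is $I_M$). A proper $N\in M$ is pseudo-primary if for all $a\in L$, $X\in M$, $aX\leqslant N$ implies $a\leqslant (N:I_M)$ or $X\leqslant rad(N)$. *)

theory Defs
  imports Main
begin

unbundle lattice_syntax

section \<open>Multiplicative lattices\<close>

definition (in complete_lattice) compact_element :: "'a \<Rightarrow> bool" where
  "compact_element a \<longleftrightarrow> (\<forall>X. a \<le> \<Squnion>X \<longrightarrow> (\<exists>F. finite F \<and> F \<subseteq> X \<and> a \<le> \<Squnion>F))"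

text \<open>The whole type is the lattice. Its least element is \<open>\<bottom>\<close>; its greatest element \<open>\<top>\<close> is
  the multiplicative unit \<open>1\<close>.\<close>

class multiplicative_lattice = complete_lattice + comm_monoid_mult +
  assumes one_eq_top: "1 = \<top>"
    and mult_Sup_distrib: "a * \<Squnion>X = (\<Squnion>x\<in>X. a * x)"

text \<open>The closure of the compact elements under binary products, together with compactness of
  \<open>1\<close> (the empty product), gives closure under all finite products.\<close>

class compactly_generated_multiplicative_lattice = multiplicative_lattice +
  assumes join_of_compact: "\<exists>X. (\<forall>x\<in>X. compact_element x) \<and> a = \<Squnion>X"
    and compact_one: "compact_element 1"
    and compact_mult: "compact_element a \<Longrightarrow> compact_element b \<Longrightarrow> compact_element (a * b)"

definition residual :: "'l::multiplicative_lattice \<Rightarrow> 'l \<Rightarrow> 'l" where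
  "residual a b = \<Squnion>{x. x * b \<le> a}"

definition principal :: "'l::multiplicative_lattice \<Rightarrow> bool" where
  "principal e \<longleftrightarrow>
    (\<forall>a b. a \<sqinter> (b * e) = (residual a e \<sqinter> b) * e) \<and>
    (\<forall>a b. residual ((a * e) \<squnion> b) e = residual b e \<squnion> a)"

definition PG_lattice :: "'l::multiplicative_lattice itself \<Rightarrow> bool" where
  "PG_lattice _ \<longleftrightarrow> (\<forall>a::'l. \<exists>E. (\<forall>e\<in>E. principal e) \<and> a = \<Squnion>E)"


section \<open>Lattice modules\<close>

text \<open>A module is given by its scalar multiplication \<open>smult\<close>; \<open>I\<^sub>M\<close> and \<open>O\<^sub>M\<close> are the top and
  bottom elements of the type \<open>'m\<close>.\<close>

locale lattice_module =
  fixes smult :: "'l::multiplicative_lattice \<Rightarrow> 'm::complete_lattice \<Rightarrow> 'm"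
  assumes Sup_smult_distrib: "smult (\<Squnion>X) A = (\<Squnion>x\<in>X. smult x A)"
    and smult_Sup_distrib: "smult a (\<Squnion>Y) = (\<Squnion>A\<in>Y. smult a A)"
    and smult_assoc: "smult (a * b) A = smult a (smult b A)"
    and smult_one: "smult 1 A = A"
    and smult_bot: "smult \<bottom> A = \<bottom>"

definition module_residual ::
    "('l::multiplicative_lattice \<Rightarrow> 'm::complete_lattice \<Rightarrow> 'm) \<Rightarrow> 'm \<Rightarrow> 'm \<Rightarrow> 'l" where
  "module_residual smult A B = \<Squnion>{x. smult x B \<le> A}"

definition faithful ::
    "('l::multiplicative_lattice \<Rightarrow> 'm::complete_lattice \<Rightarrow> 'm) \<Rightarrow> bool" where
  "faithful smult \<longleftrightarrow> module_residual smult \<bottom> \<top> = \<bottom>"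

definition multiplication_module ::
    "('l::multiplicative_lattice \<Rightarrow> 'm::complete_lattice \<Rightarrow> 'm) \<Rightarrow> bool" where
  "multiplication_module smult \<longleftrightarrow> (\<forall>N. \<exists>a. N = smult a \<top>)"

definition module_principal ::
    "('l::multiplicative_lattice \<Rightarrow> 'm::complete_lattice \<Rightarrow> 'm) \<Rightarrow> 'm \<Rightarrow> bool" where
  "module_principal smult N \<longleftrightarrow>
    (\<forall>b B. smult (b \<sqinter> module_residual smult B N) N = smult b N \<sqinter> B) \<and>
    (\<forall>b B. b \<squnion> module_residual smult B N = module_residual smult (smult b N \<squnion> B) N)"

definition PG_module ::
    "('l::multiplicative_lattice \<Rightarrow> 'm::complete_lattice \<Rightarrow> 'm) \<Rightarrow> bool" where
  "PG_module smult \<longleftrightarrow> (\<forall>N. \<exists>E. (\<forall>e\<in>E. module_principal smult e) \<and> N = \<Squnion>E)"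

definition proper :: "'m::complete_lattice \<Rightarrow> bool" where
  "proper N \<longleftrightarrow> N < \<top>"

definition prime_element ::
    "('l::multiplicative_lattice \<Rightarrow> 'm::complete_lattice \<Rightarrow> 'm) \<Rightarrow> 'm \<Rightarrow> bool" where
  "prime_element smult N \<longleftrightarrow> proper N \<and>
    (\<forall>a X. smult a X \<le> N \<longrightarrow> X \<le> N \<or> smult a \<top> \<le> N)"

definition rad ::
    "('l::multiplicative_lattice \<Rightarrow> 'm::complete_lattice \<Rightarrow> 'm) \<Rightarrow> 'm \<Rightarrow> 'm" where
  "rad smult N = \<Sqinter>{P. prime_element smult P \<and> N \<le> P}"

definition pseudo_primary ::
    "('l::multiplicative_lattice \<Rightarrow> 'm::complete_lattice \<Rightarrow> 'm) \<Rightarrow> 'm \<Rightarrow> bool" where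
  "pseudo_primary smult N \<longleftrightarrow> proper N \<and>
    (\<forall>a X. smult a X \<le> N \<longrightarrow> a \<le> module_residual smult N \<top> \<or> X \<le> rad smult N)"

end

theory Submission
  imports Defs
begin

text \<open>Faithfulness and compactness of \<open>I\<^sub>M\<close> make \<open>a \<mapsto> aI\<^sub>M\<close> an order embedding: if
  \<open>I\<^sub>M = X\<^sub>1 \<squnion> \<dots> \<squnion> X\<^sub>n\<close> with \<open>X\<^sub>i\<close> principal and \<open>\<theta> = \<Squnion>\<^sub>i (X\<^sub>i : I\<^sub>M)\<close>, then \<open>\<theta>X\<^sub>i = X\<^sub>i\<close>, hence
  \<open>\<theta> \<squnion> (O\<^sub>M : X\<^sub>i) = 1\<close> for every \<open>i\<close>, hence \<open>\<theta> = 1\<close>; and \<open>aI\<^sub>M \<le> bI\<^sub>M\<close> gives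
  \<open>a(X\<^sub>i : I\<^sub>M) \<le> b\<close> for every \<open>i\<close>. Therefore primes of \<open>L\<close> induce primes of \<open>M\<close>, and Krull's
  argument shows that a compact \<open>c\<close> with \<open>cI\<^sub>M \<le> rad(N)\<close> satisfies \<open>c\<^sup>kI\<^sub>M \<le> N\<close> for some \<open>k\<close>.
  If \<open>abI\<^sub>M \<le> rad(N)\<close> with \<open>a\<close>, \<open>b\<close> compact, then \<open>a\<^sup>kb\<^sup>kI\<^sub>M \<le> N\<close>, and being pseudo-primary puts
  \<open>a\<^sup>kI\<^sub>M\<close> or \<open>b\<^sup>kI\<^sub>M\<close>, and so \<open>aI\<^sub>M\<close> or \<open>bI\<^sub>M\<close>, below \<open>rad(N)\<close>.\<close>

section \<open>Arithmetic and prime elements of \<open>L\<close>\<close>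

lemma mult_sup_distrib:
  fixes a b c :: "'l::multiplicative_lattice"
  shows "a * (b \<squnion> c) = a * b \<squnion> a * c"
  using mult_Sup_distrib[of a "{b, c}"] by simp

lemma sup_mult_distrib:
  fixes a b c :: "'l::multiplicative_lattice"
  shows "(b \<squnion> c) * a = b * a \<squnion> c * a"
  by (metis mult.commute mult_sup_distrib)

lemma lattice_mult_mono:
  fixes a b c d :: "'l::multiplicative_lattice"
  assumes "a \<le> b" and "c \<le> d"
  shows "a * c \<le> b * d"
  using assms by (metis le_iff_sup mult_sup_distrib order_trans sup.cobounded1 sup_mult_distrib)

lemma mult_le_left:
  fixes a b :: "'l::multiplicative_lattice"
  shows "a * b \<le> a"
  using lattice_mult_mono[of a a b 1] by (metis mult_1_right one_eq_top order_refl top_greatest)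

lemma mult_le_right:
  fixes a b :: "'l::multiplicative_lattice"
  shows "a * b \<le> b"
  by (metis mult.commute mult_le_left)

text \<open>Three of the four products in the expansion have a factor \<open>p\<close>, so they lie
  below \<open>p\<close>.\<close>

lemma sup_mult_le:
  fixes p a b :: "'l::multiplicative_lattice"
  shows "(p \<squnion> a) * (p \<squnion> b) \<le> p \<squnion> a * b"
proof -
  have "p * b \<squnion> a * b \<le> p \<squnion> a * b"
    by (rule sup_mono) (simp_all add: mult_le_left)
  moreover have "p * p \<squnion> a * p \<le> p \<squnion> a * b"
    by (simp add: mult_le_left mult_le_right le_supI1)
  ultimately show ?thesis
    by (simp add: mult_sup_distrib sup_mult_distrib)
qed

lemma compact_power:
  fixes c :: "'l::compactly_generated_multiplicative_lattice"
  assumes "compact_element c"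
  shows "compact_element (c ^ k)"
  by (induction k) (simp_all add: compact_one compact_mult assms)

lemma finite_chain_Sup_mem:
  fixes F :: "'a::complete_lattice set"
  assumes "finite F" and "F \<noteq> {}" and "\<And>x y. x \<in> F \<Longrightarrow> y \<in> F \<Longrightarrow> x \<le> y \<or> y \<le> x"
  shows "\<Squnion>F \<in> F"
  using assms
proof (induction F rule: finite_ne_induct)
  case (singleton x)
  then show ?case by simp
next
  case (insert x F)
  then have "\<Squnion>F \<in> F" by blast
  with insert.prems[of x "\<Squnion>F"] show ?case
    by (auto simp: sup_absorb1 sup_absorb2)
qed

text \<open>Zorn gives a \<open>p\<close> maximal among the elements above \<open>n\<close> that
  dominate no power of \<open>c\<close>; maximality forces it to be prime. Compactness of the powers
  of \<open>c\<close> keeps this set closed under joins of nonempty chains.\<close>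

lemma exists_prime_above:
  fixes c n :: "'l::compactly_generated_multiplicative_lattice"
  assumes c: "compact_element c" and n: "\<And>k. \<not> c ^ k \<le> n"
  obtains p where "n \<le> p" and "\<And>k. \<not> c ^ k \<le> p"
    and "\<And>x y. x * y \<le> p \<Longrightarrow> x \<le> p \<or> y \<le> p"
proof -
  define A where "A = {q. n \<le> q \<and> (\<forall>k. \<not> c ^ k \<le> q)}"
  have "\<exists>p\<in>A. \<forall>q\<in>A. p \<le> q \<longrightarrow> q = p"
  proof (rule predicate_Zorn)
    show "partial_order_on A (relation_of (\<le>) A)"
      by (rule partial_order_on_relation_ofI) auto
  next
    fix C assume "C \<in> Chains (relation_of (\<le>) A)"
    then have sub: "C \<subseteq> A"
      and lin: "\<And>x y. x \<in> C \<Longrightarrow> y \<in> C \<Longrightarrow> x \<le> y \<or> y \<le> x"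
      by (auto simp: Chains_def relation_of_def)
    show "\<exists>u\<in>A. \<forall>q\<in>C. q \<le> u"
    \<comment> \<open>The empty chain is bounded by \<open>n\<close>, since its join
      \<open>\<bottom>\<close> may fail to lie above \<open>n\<close>.\<close>
    proof (cases "C = {}")
      case True
      then show ?thesis using n by (auto simp: A_def)
    next
      case False
      have "\<not> c ^ k \<le> \<Squnion>C" for k
      proof
        assume "c ^ k \<le> \<Squnion>C"
        then obtain F where F: "finite F" "F \<subseteq> C" "c ^ k \<le> \<Squnion>F"
          using compact_power[OF c, of k] unfolding compact_element_def by blast
        show False
        proof (cases "F = {}")
          case True
          then show False using F n[of k] by (simp add: bot_unique)
        next
          case False
          then have "\<Squnion>F \<in> F" using F lin by (intro finite_chain_Sup_mem) auto
          then show False using F sub by (auto simp: A_def)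
        qed
      qed
      moreover have "n \<le> \<Squnion>C"
        using False sub by (auto simp: A_def intro: Sup_upper2)
      ultimately show ?thesis by (auto simp: A_def intro: Sup_upper)
    qed
  qed
  then obtain p where p: "p \<in> A" and max: "\<And>q. q \<in> A \<Longrightarrow> p \<le> q \<Longrightarrow> q = p"
    by blast
  \<comment> \<open>By maximality, enlarging \<open>p\<close> by any \<open>x\<close> not below it
    leaves \<open>A\<close>, so some power of \<open>c\<close> gets captured.\<close>
  have pow: "\<exists>k. c ^ k \<le> p \<squnion> x" if "\<not> x \<le> p" for x
  proof (rule ccontr)
    assume "\<nexists>k. c ^ k \<le> p \<squnion> x"
    then have "p \<squnion> x \<in> A" using p by (auto simp: A_def intro: le_supI1)
    then have "p \<squnion> x = p" by (rule max) simp
    with that show False by (simp add: le_iff_sup sup.commute)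
  qed
  have "x \<le> p \<or> y \<le> p" if xy: "x * y \<le> p" for x y
  proof (rule ccontr)
    assume "\<not> (x \<le> p \<or> y \<le> p)"
    then obtain j k where "c ^ j \<le> p \<squnion> x" "c ^ k \<le> p \<squnion> y" using pow by blast
    then have "c ^ (j + k) \<le> (p \<squnion> x) * (p \<squnion> y)"
      by (simp add: power_add lattice_mult_mono)
    also have "\<dots> \<le> p" using sup_mult_le[of p x y] xy by (simp add: sup_absorb1)
    finally show False using p by (auto simp: A_def)
  qed
  with p show thesis by (intro that) (auto simp: A_def)
qed

section \<open>Residuals and cancellation of \<open>\<top>\<close> in the module\<close>

context lattice_module
begin

lemma smult_sup_distrib: "smult a (A \<squnion> B) = smult a A \<squnion> smult a B"
  using smult_Sup_distrib[of a "{A, B}"] by simp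

lemma sup_smult_distrib: "smult (a \<squnion> b) A = smult a A \<squnion> smult b A"
  using Sup_smult_distrib[of "{a, b}" A] by simp

lemma smult_mono:
  assumes "a \<le> b" and "A \<le> B"
  shows "smult a A \<le> smult b B"
  using assms by (metis le_iff_sup smult_sup_distrib order_trans sup.cobounded1 sup_smult_distrib)

lemma smult_left_commute: "smult a (smult b A) = smult b (smult a A)"
  by (metis mult.commute smult_assoc)

lemma smult_le: "smult a A \<le> A"
  using smult_mono[of a 1 A A] by (simp add: one_eq_top smult_one[unfolded one_eq_top])

lemma module_residual_smult_le: "smult (module_residual smult A B) B \<le> A"
  by (auto simp: module_residual_def Sup_smult_distrib intro: SUP_least)

text \<open>Scalars act distributively over joins, so the join defining the residual is itself a
  member: residuation is right adjoint to the action.\<close>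

lemma le_module_residual_iff: "x \<le> module_residual smult A B \<longleftrightarrow> smult x B \<le> A"
proof
  assume "x \<le> module_residual smult A B"
  then show "smult x B \<le> A"
    using smult_mono[of x "module_residual smult A B" B B] module_residual_smult_le[of A B]
    by simp
qed (simp add: module_residual_def Sup_upper)

lemma multiplication_module_residual:
  assumes "multiplication_module smult"
  shows "smult (module_residual smult N \<top>) \<top> = N"
proof (rule antisym[OF module_residual_smult_le])
  obtain a where a: "N = smult a \<top>"
    using assms unfolding multiplication_module_def by blast
  then have "a \<le> module_residual smult N \<top>" by (simp add: le_module_residual_iff)
  then have "smult a \<top> \<le> smult (module_residual smult N \<top>) \<top>" by (simp add: smult_mono)
  with a show "N \<le> smult (module_residual smult N \<top>) \<top>" by simp
qed

text \<open>The product of the annihilators of two elements kills their join, and by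
  \<open>sup_mult_le\<close> it is still comaximal with \<open>b\<close>.\<close>

lemma sup_annihilator_Sup:
  assumes "finite F" and "\<And>X. X \<in> F \<Longrightarrow> b \<squnion> module_residual smult \<bottom> X = 1"
  shows "b \<squnion> module_residual smult \<bottom> (\<Squnion>F) = 1"
  using assms
proof (induction F)
  case empty
  have "(1 :: 'l) \<le> module_residual smult \<bottom> \<bottom>"
    by (simp add: le_module_residual_iff smult_one)
  then show ?case by (simp add: one_eq_top top_unique)
next
  case (insert X F)
  let ?u = "module_residual smult \<bottom> X" and ?v = "module_residual smult \<bottom> (\<Squnion>F)"
  have "smult (?u * ?v) X \<le> \<bottom>" "smult (?u * ?v) (\<Squnion>F) \<le> \<bottom>"
    by (simp_all add: le_module_residual_iff[symmetric] mult_le_left mult_le_right)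
  then have "?u * ?v \<le> module_residual smult \<bottom> (\<Squnion>(insert X F))"
    by (simp add: le_module_residual_iff smult_sup_distrib)
  moreover have "(b \<squnion> ?u) * (b \<squnion> ?v) = 1" using insert by simp
  then have "1 \<le> b \<squnion> ?u * ?v" by (metis sup_mult_le)
  ultimately have "1 \<le> b \<squnion> module_residual smult \<bottom> (\<Squnion>(insert X F))"
    by (meson order_trans sup_mono order_refl)
  then show ?case by (simp add: one_eq_top top_unique)
qed

text \<open>This is the second identity for principal elements at \<open>B = \<bottom>\<close>, read
  through the adjunction.\<close>

lemma smult_principal_le_iff:
  assumes "module_principal smult X"
  shows "smult a X \<le> smult b X \<longleftrightarrow> a \<le> b \<squnion> module_residual smult \<bottom> X"
proof -
  have "b \<squnion> module_residual smult \<bottom> X = module_residual smult (smult b X \<squnion> \<bottom>) X"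
    using assms unfolding module_principal_def by blast
  then show ?thesis by (simp add: le_module_residual_iff)
qed

lemma smult_top_le_iff:
  assumes "faithful smult" and mult: "multiplication_module smult" and "PG_module smult"
    and top: "compact_element (\<top> :: 'm)"
  shows "smult a \<top> \<le> smult b \<top> \<longleftrightarrow> a \<le> b"
proof
  assume ab: "smult a \<top> \<le> smult b \<top>"
  obtain E where E: "\<forall>X\<in>E. module_principal smult X" "\<top> = \<Squnion>E"
    using assms(3)[unfolded PG_module_def, rule_format, of \<top>] by (elim exE conjE)
  obtain F where F: "finite F" "F \<subseteq> E" "\<top> = \<Squnion>F"
    using top[unfolded compact_element_def, rule_format, OF eq_refl[OF E(2)]]
    by (auto simp: top_unique)
  let ?r = "\<lambda>X. module_residual smult X \<top>"
  define \<theta> where "\<theta> = \<Squnion>(?r ` F)"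
  have r: "smult (?r X) \<top> = X" for X
    by (rule multiplication_module_residual[OF mult])
  have "smult \<theta> \<top> = \<top>"
    using F(3) by (simp add: \<theta>_def Sup_smult_distrib image_image r)
  \<comment> \<open>Write \<open>X\<close> as \<open>?r X\<close> acting on \<open>\<top>\<close>
    and let the two scalars commute.\<close>
  then have \<theta>: "smult \<theta> X = X" for X
    by (metis r smult_left_commute)
  have "\<theta> \<squnion> module_residual smult \<bottom> X = 1" if "X \<in> F" for X
  proof -
    have "smult 1 X \<le> smult \<theta> X" by (simp add: \<theta> smult_one)
    then show ?thesis
      using smult_principal_le_iff[of X 1 \<theta>] that E F by (auto simp: one_eq_top top_unique)
  qed
  then have "\<theta> \<squnion> module_residual smult \<bottom> (\<Squnion>F) = 1"
    by (rule sup_annihilator_Sup[OF F(1)])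
  \<comment> \<open>The join of \<open>F\<close> is \<open>\<top>\<close>, whose annihilator is
    \<open>\<bottom>\<close> by faithfulness.\<close>
  with assms(1) F(3) have one: "\<theta> = 1" by (simp add: faithful_def)
  have "a * ?r X \<le> b" if "X \<in> F" for X
  proof -
    let ?u = "module_residual smult \<bottom> X"
    have "smult (?r X) (smult a \<top>) \<le> smult (?r X) (smult b \<top>)"
      using ab by (simp add: smult_mono)
    then have "smult a X \<le> smult b X" by (simp add: smult_left_commute[of "?r X"] r)
    then have "a \<le> b \<squnion> ?u" using smult_principal_le_iff that E F by blast
    then have "a * ?r X \<le> b * ?r X \<squnion> ?u * ?r X"
      by (metis lattice_mult_mono order_refl sup_mult_distrib)
    \<comment> \<open>\<open>?r X\<close> carries \<open>\<top>\<close> to \<open>X\<close>, which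
      \<open>?u\<close> kills; faithfulness then removes the error term.\<close>
    moreover have "smult (?u * ?r X) \<top> \<le> \<bottom>"
      using module_residual_smult_le[of \<bottom> X] by (simp add: smult_assoc r)
    then have "?u * ?r X = \<bottom>"
      unfolding le_module_residual_iff[symmetric] assms(1)[unfolded faithful_def]
      by (simp add: bot_unique)
    ultimately show ?thesis
      using mult_le_left[of b "?r X"] by (simp add: order_trans)
  qed
  then have "a * \<theta> \<le> b"
    by (auto simp: \<theta>_def mult_Sup_distrib intro: SUP_least)
  then show "a \<le> b" by (simp add: one)
qed (simp add: smult_mono)

text \<open>Every \<open>X\<close> is some \<open>b\<close> acting on \<open>\<top>\<close>, so
  cancellation turns the primeness condition for the module into that for \<open>p\<close>.\<close>

lemma prime_smult_top:
  assumes mult: "multiplication_module smult"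
    and cancel: "\<And>a b. smult a \<top> \<le> smult b \<top> \<longleftrightarrow> a \<le> b"
    and p: "\<not> 1 \<le> p" "\<And>x y. x * y \<le> p \<Longrightarrow> x \<le> p \<or> y \<le> p"
  shows "prime_element smult (smult p \<top>)"
proof -
  have "smult p \<top> \<noteq> \<top>"
    using cancel[of 1 p] p(1) by (auto simp: smult_one)
  moreover have "X \<le> smult p \<top> \<or> smult a \<top> \<le> smult p \<top>" if aX: "smult a X \<le> smult p \<top>" for a X
  proof -
    obtain b where b: "X = smult b \<top>"
      using mult unfolding multiplication_module_def by blast
    then have "a * b \<le> p" using aX by (simp add: cancel[symmetric] smult_assoc)
    with p(2) show ?thesis unfolding b cancel by blast
  qed
  ultimately show ?thesis
    unfolding prime_element_def proper_def by (simp add: top.not_eq_extremum)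
qed

lemma prime_power_smult_le:
  assumes "prime_element smult P" and "smult (d ^ k) \<top> \<le> P"
  shows "smult d \<top> \<le> P"
  using assms(2)
proof (induction k)
  case 0
  then show ?case using smult_le[of d \<top>] by (simp add: smult_one top_unique)
next
  case (Suc k)
  then show ?case
    using assms(1) unfolding prime_element_def by (auto simp: smult_assoc)
qed

lemma rad_power_smult_le:
  assumes "smult (d ^ k) \<top> \<le> rad smult N"
  shows "smult d \<top> \<le> rad smult N"
  unfolding rad_def
proof (rule Inf_greatest)
  fix P assume "P \<in> {P. prime_element smult P \<and> N \<le> P}"
  moreover from this have "rad smult N \<le> P" unfolding rad_def by (rule Inf_lower)
  ultimately show "smult d \<top> \<le> P"
    using assms prime_power_smult_le[of P d k] by auto
qed

end

section \<open>The radical\<close>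

lemma le_rad: "N \<le> rad smult N"
  by (auto simp: rad_def intro: Inf_greatest)

text \<open>Otherwise a prime \<open>p\<close> of \<open>L\<close> above the residual of
  \<open>N\<close> avoids all powers of \<open>c\<close>, and it induces a prime of the module above
  \<open>N\<close> but not above \<open>smult c \<top>\<close>.\<close>

lemma compact_smult_le_rad:
  fixes smult :: "'l::compactly_generated_multiplicative_lattice \<Rightarrow> 'm::complete_lattice \<Rightarrow> 'm"
  assumes "lattice_module smult" and "faithful smult" and mult: "multiplication_module smult"
    and "PG_module smult" and "compact_element (\<top> :: 'm)"
    and c: "compact_element c" and le: "smult c \<top> \<le> rad smult N"
  shows "\<exists>k. smult (c ^ k) \<top> \<le> N"
proof (rule ccontr)
  interpret lattice_module smult by fact
  note cancel = smult_top_le_iff[OF assms(2-5)]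
  assume "\<nexists>k. smult (c ^ k) \<top> \<le> N"
  then have "\<not> c ^ k \<le> module_residual smult N \<top>" for k
    by (simp add: le_module_residual_iff)
  then obtain p where p: "module_residual smult N \<top> \<le> p" "\<And>k. \<not> c ^ k \<le> p"
    "\<And>x y. x * y \<le> p \<Longrightarrow> x \<le> p \<or> y \<le> p"
    using exists_prime_above[OF c] by blast
  have "prime_element smult (smult p \<top>)"
    \<comment> \<open>The exponent 0 says that \<open>1\<close> is not below \<open>p\<close>, which
      yields properness.\<close>
    using p(2)[of 0] p(3) by (intro prime_smult_top[OF mult cancel]) auto
  moreover have "N \<le> smult p \<top>"
    using p(1) multiplication_module_residual[OF mult, of N] cancel by metis
  ultimately have "rad smult N \<le> smult p \<top>"
    unfolding rad_def by (intro Inf_lower) simp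
  with le have "c \<le> p" using cancel by (meson order_trans)
  with p(2)[of 1] show False by simp
qed

text \<open>This reduces a failure of primeness to compact scalars, the only ones to which the power
  criterion applies.\<close>

lemma exists_compact_smult_not_le:
  fixes smult :: "'l::compactly_generated_multiplicative_lattice \<Rightarrow> 'm::complete_lattice \<Rightarrow> 'm"
  assumes "lattice_module smult" and "\<not> smult a A \<le> B"
  obtains c where "compact_element c" and "c \<le> a" and "\<not> smult c A \<le> B"
proof -
  interpret lattice_module smult by fact
  obtain S where S: "\<forall>x\<in>S. compact_element x" "a = \<Squnion>S"
    using join_of_compact by blast
  with assms(2) have "\<exists>c\<in>S. \<not> smult c A \<le> B"
    by (auto simp: Sup_smult_distrib SUP_le_iff)
  with S show thesis by (auto intro: that Sup_upper)
qed

theorem theorem2p17: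
  fixes smult :: "'l::compactly_generated_multiplicative_lattice \<Rightarrow> 'm::complete_lattice \<Rightarrow> 'm"
    and N :: 'm
  assumes "PG_lattice TYPE('l)"
    and "lattice_module smult"
    and "faithful smult"
    and "multiplication_module smult"
    and "PG_module smult"
    and "compact_element (\<top> :: 'm)"
    and "proper N"
    and "pseudo_primary smult N"
  shows "prime_element smult (rad smult N)"
proof -
  interpret lattice_module smult by fact
  note power_le = compact_smult_le_rad[OF assms(2-6)]
  \<comment> \<open>For \<open>c = 1\<close> all powers are \<open>1\<close>, so a radical equal to
    \<open>\<top>\<close> would force \<open>N\<close> to be \<open>\<top>\<close>.\<close>
  have "rad smult N \<noteq> \<top>"
    using power_le[OF compact_one, of N] \<open>proper N\<close>
    by (auto simp: smult_one proper_def top_unique)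
  moreover have "X \<le> rad smult N \<or> smult a \<top> \<le> rad smult N"
    if aX: "smult a X \<le> rad smult N" for a X
  proof (rule ccontr)
    assume neg: "\<not> (X \<le> rad smult N \<or> smult a \<top> \<le> rad smult N)"
    obtain b where b: "X = smult b \<top>"
      using assms(4) unfolding multiplication_module_def by blast
    obtain d where d: "compact_element d" "d \<le> a" "\<not> smult d \<top> \<le> rad smult N"
      using exists_compact_smult_not_le[OF assms(2)] neg by blast
    obtain e where e: "compact_element e" "e \<le> b" "\<not> smult e \<top> \<le> rad smult N"
      using exists_compact_smult_not_le[OF assms(2)] neg unfolding b by blast
    have "smult (d * e) \<top> \<le> smult a X"
      using d(2) e(2) by (simp add: b smult_assoc smult_mono)
    with aX have "smult (d * e) \<top> \<le> rad smult N" by (rule order_trans[rotated])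
    then obtain k where "smult ((d * e) ^ k) \<top> \<le> N"
      using power_le[OF compact_mult[OF d(1) e(1)]] by blast
    then have "smult (d ^ k) (smult (e ^ k) \<top>) \<le> N"
      by (simp add: power_mult_distrib smult_assoc)
    \<comment> \<open>Pseudo-primariness is applied to the scalar \<open>d ^ k\<close> and the
      element \<open>smult (e ^ k) \<top>\<close>; either outcome puts a power below the radical,
      whence \<open>d\<close> or \<open>e\<close> itself.\<close>
    then have "smult (d ^ k) \<top> \<le> N \<or> smult (e ^ k) \<top> \<le> rad smult N"
      using assms(8) unfolding pseudo_primary_def by (simp add: le_module_residual_iff)
    then show False
      using rad_power_smult_le d(3) e(3) le_rad order_trans by metis
  qed
  ultimately show ?thesis
    unfolding prime_element_def proper_def by (simp add: top.not_eq_extremum)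
qed

end
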